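(* Let $d\geq 2$ and let $\|\cdot\|$ be any norm on $\mathbb R^d$. Then \[U_{\|\cdot\|}(n)\geq \left(\frac d2-o(1)\right) n\log_2 n,\] where the $o(1)$ term tends to $0$ as $n\to\infty$ for each fixed $d$.
   Context: For a norm $\|\cdot\|$ on $\mathbb R^d$, $U_{\|\cdot\|}(n)$ denotes the maximum, over all sets $P\subset\mathbb R^d$ of $n$ points, of the number of unordered pairs $\{x,y\}\subseteq P$ with $\|x-y\|=1$ (the number of unit distances spanned by $P$). *)

theory Defs
  imports "HOL-Analysis.Analysis"
begin

definition is_norm :: "('a::real_vector \<Rightarrow> real) \<Rightarrow> bool" where
  "is_norm N \<longleftrightarrow>
     (\<forall>x. 0 \<le> N x) \<and>
     (\<forall>x. N x = 0 \<longleftrightarrow> x = 0) \<and>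
     (\<forall>a x. N (a *\<^sub>R x) = \<bar>a\<bar> * N x) \<and>
     (\<forall>x y. N (x + y) \<le> N x + N y)"

text \<open>For a norm \<open>N\<close>, \<open>N (x - y) = 1\<close> forces \<open>x \<noteq> y\<close>, so the sets below have exactly two
  elements and each unordered pair is counted once.\<close>

definition unit_pairs :: "('a::real_vector \<Rightarrow> real) \<Rightarrow> 'a set \<Rightarrow> 'a set set" where
  "unit_pairs N P = {{x, y} | x y. x \<in> P \<and> y \<in> P \<and> N (x - y) = 1}"

definition max_unit_distances :: "('a::real_vector \<Rightarrow> real) \<Rightarrow> nat \<Rightarrow> nat" where
  "max_unit_distances N n = Max {card (unit_pairs N P) | P. finite P \<and> card P = n}"

text \<open>The maximum is over a finite nonempty set, so \<open>Max\<close> is not the unspecified value.\<close>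

lemma finite_unit_pair_counts:
  fixes N :: "'a::real_vector \<Rightarrow> real"
  shows "finite {card (unit_pairs N P) | P. finite P \<and> card P = n}"
proof (rule finite_subset)
  have "card (unit_pairs N P) \<le> 2 ^ card P" if "finite P" for P
  proof -
    have "unit_pairs N P \<subseteq> Pow P"
      by (auto simp: unit_pairs_def)
    with that show ?thesis
      by (metis card_Pow card_mono finite_Pow_iff)
  qed
  then show "{card (unit_pairs N P) | P. finite P \<and> card P = n} \<subseteq> {..2 ^ n}"
    by auto
qed simp

lemma unit_pair_counts_nonempty:
  fixes N :: "real ^ 'd \<Rightarrow> real"
  shows "{card (unit_pairs N P) | P. finite P \<and> card P = n} \<noteq> {}"
proof -
  have "infinite (UNIV :: (real ^ 'd) set)"
    by (metis finite_imp_bounded not_bounded_UNIV)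
  then obtain P :: "(real ^ 'd) set" where "finite P" "card P = n"
    by (metis infinite_arbitrarily_large)
  then show ?thesis
    by blast
qed

end

theory Submission
  imports Defs "HOL-Real_Asymp.Real_Asymp"
begin

text \<open>Every norm has linearly independent functionals \<open>p\<^sub>1, \<dots>, p\<^sub>d\<close> that are strict derivatives of
  the norm at unit vectors \<open>u\<^sub>1, \<dots>, u\<^sub>d\<close>: take points where the unit sphere is touched from the
  inside by ellipsoids. Let \<open>e\<^sub>j\<close> be the dual basis. By a contraction argument, for every small \<open>t\<close>
  there is an \<open>x\<close> such that all \<open>x + u\<^sub>j - t e\<^sub>j\<close> are unit vectors. Taking \<open>t = i \<delta>\<close> for \<open>i < m\<close> and
  writing \<open>w\<^sub>j = \<delta> e\<^sub>j\<close>, this gives \<open>d m\<close> unit vectors \<open>x\<^sub>i + u\<^sub>j - i w\<^sub>j\<close>, distinct up to sign because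
  \<open>d \<ge> 2\<close>, in a group generated by \<open>m + 2 d\<close> elements. In the grid of all sums with coefficients
  \<open>0, 1\<close> at the \<open>x\<^sub>i\<close> and in \<open>[0, m\<^sup>2)\<close> at the \<open>u\<^sub>j\<close> and \<open>- w\<^sub>j\<close>, each of these vectors joins about
  half of the grid points to another one, and the grid has only \<open>m + O(log m)\<close> bits. The sums need
  not be distinct, but some superlevel set of the multiplicity function has at least the same edge
  density. Disjoint translates of it handle arbitrary \<open>n\<close>.\<close>

section \<open>Strict derivatives of a norm\<close>

lemma is_normD:
  assumes "is_norm N"
  shows is_norm_nonneg: "0 \<le> N x"
    and is_norm_eq_0_iff: "N x = 0 \<longleftrightarrow> x = 0"
    and is_norm_scaleR: "N (a *\<^sub>R x) = \<bar>a\<bar> * N x"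
    and is_norm_triangle: "N (x + y) \<le> N x + N y"
  using assms by (simp_all add: is_norm_def)

lemma is_norm_minus: "is_norm N \<Longrightarrow> N (- x) = N x"
  using is_norm_scaleR[of N "-1" x] by simp

lemma is_norm_diff_ineq:
  assumes "is_norm N"
  shows "\<bar>N x - N y\<bar> \<le> N (x - y)"
  using is_norm_triangle[OF assms, of "x - y" y] is_norm_triangle[OF assms, of "y - x" x]
    is_norm_minus[OF assms, of "x - y"] by simp

lemma is_norm_sum:
  assumes "is_norm N"
  shows "N (sum f A) \<le> (\<Sum>i\<in>A. N (f i))"
proof (induction A rule: infinite_finite_induct)
  case (insert x F)
  then show ?case using is_norm_triangle[OF assms, of "f x" "sum f F"] by simp
qed (use is_norm_eq_0_iff[OF assms, of 0] in auto)

lemma is_norm_le_norm: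
  fixes N :: "'a::euclidean_space \<Rightarrow> real"
  assumes "is_norm N"
  obtains M where "0 < M" "\<And>x. N x \<le> M * norm x"
proof
  let ?M = "1 + (\<Sum>b\<in>Basis. N b)"
  show "0 < ?M"
    using sum_nonneg[of Basis N] is_norm_nonneg[OF assms] by (simp add: add_pos_nonneg)
  show "N x \<le> ?M * norm x" for x
  proof -
    have "N x = N (\<Sum>b\<in>Basis. (x \<bullet> b) *\<^sub>R b)"
      by (simp add: euclidean_representation)
    also have "\<dots> \<le> (\<Sum>b\<in>Basis. N ((x \<bullet> b) *\<^sub>R b))"
      by (rule is_norm_sum[OF assms])
    also have "\<dots> \<le> (\<Sum>b\<in>Basis. norm x * N b)"
      by (intro sum_mono)
        (simp add: is_norm_scaleR[OF assms] Basis_le_norm mult_right_mono is_norm_nonneg[OF assms])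
    also have "\<dots> \<le> ?M * norm x"
      by (simp add: sum_distrib_left[symmetric] distrib_left mult.commute[of _ "norm x"])
    finally show ?thesis .
  qed
qed

lemma is_norm_continuous_on:
  fixes N :: "'a::euclidean_space \<Rightarrow> real"
  assumes "is_norm N"
  shows "continuous_on S N"
proof -
  obtain M where M: "0 < M" "\<And>x. N x \<le> M * norm x"
    using is_norm_le_norm[OF assms] by blast
  have "M-lipschitz_on S N"
    using M is_norm_diff_ineq[OF assms]
    by (intro lipschitz_onI) (auto simp: dist_norm intro: order_trans)
  then show ?thesis
    by (rule lipschitz_on_continuous_on)
qed

section \<open>Points where an inscribed ellipsoid touches the unit sphere\<close>

text \<open>Take the largest multiple of an ellipsoid elongated along \<open>w\<close> that fits
  into the unit ball; it touches the sphere at \<open>u\<close>. There \<open>N\<close> lies below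
  the square root of the quadratic form, hence the quadratic upper bound, and convexity turns this
  into the linear lower bound. The elongation keeps \<open>u\<close> off the hyperplane orthogonal
  to \<open>w\<close>, which gives \<open>p \<bullet> w \<noteq> 0\<close>.\<close>

lemma quadratic_supporting_point:
  fixes N :: "'a::euclidean_space \<Rightarrow> real"
  assumes N: "is_norm N" and "w \<noteq> 0"
  obtains u p C where "N u = 1" "p \<bullet> w \<noteq> 0" "0 \<le> C"
    "\<And>h. 1 + p \<bullet> h \<le> N (u + h)" "\<And>h. N (u + h) \<le> 1 + p \<bullet> h + C * (norm h)\<^sup>2"
proof -
  define v where "v = sgn w"
  have nv: "norm v = 1" and v0: "v \<noteq> 0"
    using \<open>w \<noteq> 0\<close> by (auto simp: v_def norm_sgn sgn_zero_iff)
  have vv: "v \<bullet> v = 1"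
    using nv by (simp add: dot_square_norm)
  obtain M where M: "0 < M" "\<And>x. N x \<le> M * norm x"
    using is_norm_le_norm[OF N] by blast
  have Nv: "0 < N v"
    using is_norm_nonneg[OF N, of v] is_norm_eq_0_iff[OF N, of v] v0 by auto
  \<comment> \<open>If the touching point \<open>u\<close> were orthogonal to \<open>v\<close>, then
    \<open>S \<le> M\<^sup>2\<close>, while \<open>(N v)\<^sup>2 \<le> S * l\<close>. The factor 2
    in the denominator makes these two bounds contradictory.\<close>
  define l where "l = (N v)\<^sup>2 / (2 * M\<^sup>2)"
  have "(N v)\<^sup>2 \<le> M\<^sup>2"
    using M(2)[of v] Nv nv by (intro power_mono) auto
  moreover have "0 < M\<^sup>2"
    using M(1) by simp
  ultimately have "(N v)\<^sup>2 < 2 * M\<^sup>2" "0 < M\<^sup>2"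
    by linarith+
  then have l: "0 < l" "l < 1"
    using Nv by (simp_all add: l_def)
  define q where "q x = x \<bullet> x - (1 - l) * (x \<bullet> v)\<^sup>2" for x
  have cs: "(x \<bullet> v)\<^sup>2 \<le> x \<bullet> x" for x
    using Cauchy_Schwarz_ineq[of x v] vv by simp
  have q_ge: "l * (x \<bullet> x) \<le> q x" for x
    using mult_left_mono[OF cs, of "1 - l" x] l by (simp add: q_def algebra_simps)
  have q_le: "q x \<le> x \<bullet> x" for x
    using l by (simp add: q_def)
  have q_pos: "0 < q x" if "x \<noteq> 0" for x
    using q_ge[of x] l that by (metis inner_gt_zero_iff mult_pos_pos order_less_le_trans)
  have q_scale: "q (a *\<^sub>R x) = a\<^sup>2 * q x" for a x
    by (simp add: q_def power2_eq_square algebra_simps)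
  have q_add: "q (x + y) = q x + 2 * (x \<bullet> y - (1 - l) * (x \<bullet> v) * (y \<bullet> v)) + q y" for x y
    by (simp add: q_def power2_eq_square algebra_simps inner_commute)
  \<comment> \<open>The quotient is homogeneous of degree 0, so its maximum \<open>S\<close> over
    the Euclidean sphere bounds it at all nonzero vectors.\<close>
  have "\<exists>z\<in>sphere 0 1. \<forall>x\<in>sphere 0 1. (N x)\<^sup>2 / q x \<le> (N z)\<^sup>2 / q z"
  proof (rule continuous_attains_sup)
    show "sphere (0::'a) 1 \<noteq> {}"
      using nv by (auto simp: sphere_def)
    have "q x \<noteq> 0" if "x \<in> sphere 0 1" for x
      using q_pos[of x] that by fastforce
    moreover have "continuous_on (sphere 0 1) q"
      unfolding q_def by (intro continuous_intros)
    ultimately show "continuous_on (sphere 0 1) (\<lambda>x. (N x)\<^sup>2 / q x)"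
      by (intro continuous_intros is_norm_continuous_on[OF N]) auto
  qed auto
  then obtain z where z: "norm z = 1" "\<And>x. norm x = 1 \<Longrightarrow> (N x)\<^sup>2 / q x \<le> (N z)\<^sup>2 / q z"
    by auto
  define S where "S = (N z)\<^sup>2 / q z"
  have z0: "z \<noteq> 0" using z(1) by auto
  then have Nz: "0 < N z"
    using is_norm_nonneg[OF N, of z] is_norm_eq_0_iff[OF N, of z] by auto
  have S: "0 < S"
    using Nz q_pos[OF z0] by (simp add: S_def)
  have NS: "(N x)\<^sup>2 \<le> S * q x" for x
  proof (cases "x = 0")
    case True
    then show ?thesis using is_norm_eq_0_iff[OF N, of 0] by (simp add: q_def)
  next
    case False
    define y where "y = sgn x"
    have y: "norm y = 1" "x = norm x *\<^sub>R y"
      using False by (auto simp: y_def norm_sgn sgn_div_norm)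
    have "(N y)\<^sup>2 \<le> S * q y"
      using z(2)[OF y(1)] q_pos[of y] y(1) by (fastforce simp: S_def field_simps)
    then have "(norm x)\<^sup>2 * (N y)\<^sup>2 \<le> (norm x)\<^sup>2 * (S * q y)"
      by (intro mult_left_mono) auto
    moreover have "N x = norm x * N y" "q x = (norm x)\<^sup>2 * q y"
      using is_norm_scaleR[OF N, of "norm x" y] q_scale[of "norm x" y] y(2) by simp_all
    ultimately show ?thesis
      by (simp add: power_mult_distrib mult.left_commute)
  qed
  define u where "u = (1 / N z) *\<^sub>R z"
  have Nu: "N u = 1"
    using is_norm_scaleR[OF N, of "1 / N z" z] Nz by (simp add: u_def)
  have Squ: "S * q u = 1"
    using Nz q_pos[OF z0] by (simp add: u_def q_scale S_def power_divide)
  \<comment> \<open>This is the gradient at \<open>u\<close> of the square root of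
    \<open>S * q\<close>, whose value there is 1.\<close>
  define p where "p = S *\<^sub>R (u - ((1 - l) * (u \<bullet> v)) *\<^sub>R v)"
  have ph: "p \<bullet> h = S * (u \<bullet> h - (1 - l) * (u \<bullet> v) * (h \<bullet> v))" for h
    by (simp add: p_def inner_diff_left inner_commute[of v h])
  have "u \<bullet> v \<noteq> 0"
  proof
    assume "u \<bullet> v = 0"
    then have "q u = (norm u)\<^sup>2"
      by (simp add: q_def dot_square_norm)
    moreover have "1 \<le> M\<^sup>2 * (norm u)\<^sup>2"
      using power_mono[OF M(2)[of u], of 2] Nu by (simp add: power_mult_distrib)
    ultimately have "S * q u \<le> M\<^sup>2 * q u"
      using Squ by simp
    moreover have "0 < q u"
      using Squ S by (metis zero_less_mult_pos zero_less_one)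
    ultimately have "S \<le> M\<^sup>2"
      by simp
    moreover have "(N v)\<^sup>2 \<le> S * l"
      using NS[of v] vv by (simp add: q_def)
    ultimately have "(N v)\<^sup>2 \<le> M\<^sup>2 * l"
      using l mult_right_mono[of S "M\<^sup>2" l] by linarith
    then show False
      using Nv M(1) by (simp add: l_def)
  qed
  moreover have "p \<bullet> v = S * l * (u \<bullet> v)"
    by (simp add: ph vv algebra_simps)
  moreover have "w = norm w *\<^sub>R v"
    using \<open>w \<noteq> 0\<close> by (simp add: v_def sgn_div_norm)
  ultimately have pw: "p \<bullet> w \<noteq> 0"
    using S l \<open>w \<noteq> 0\<close> by (metis inner_scaleR_right mult_eq_0_iff norm_eq_zero less_irrefl)
  have upper: "N (u + h) \<le> 1 + p \<bullet> h + S / 2 * (norm h)\<^sup>2" for h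
  proof -
    define a where "a = 2 * (p \<bullet> h) + S * q h"
    have Sq: "S * q (u + h) = 1 + a"
      using Squ by (simp add: q_add a_def ph distrib_left)
    have "0 \<le> 1 + a"
      using order_trans[OF zero_le_power2 NS[of "u + h"]] Sq by simp
    have "(N (u + h))\<^sup>2 \<le> 1 + a"
      using NS[of "u + h"] Sq by simp
    also have "1 + a \<le> (1 + a / 2)\<^sup>2"
      by (simp add: power2_eq_square algebra_simps)
    finally have "N (u + h) \<le> 1 + a / 2"
      by (rule power2_le_imp_le) (use \<open>0 \<le> 1 + a\<close> in linarith)
    also have "\<dots> \<le> 1 + p \<bullet> h + S / 2 * (norm h)\<^sup>2"
      using mult_left_mono[OF q_le[of h], of S] S by (simp add: a_def dot_square_norm)
    finally show ?thesis .
  qed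
  \<comment> \<open>By the triangle inequality, too small a value at \<open>u + h\<close> would
    force a value at \<open>u - t *\<^sub>R h\<close> that the upper bound forbids for small
    \<open>t\<close>: after division by \<open>t\<close>, the quadratic error is only
    \<open>c * t\<close>.\<close>
  have lower: "1 + p \<bullet> h \<le> N (u + h)" for h
  proof (rule field_le_epsilon)
    fix e :: real assume "0 < e"
    define c where "c = S / 2 * (norm h)\<^sup>2"
    have "0 \<le> c" using S by (simp add: c_def)
    define t where "t = e / (c + 1)"
    have t: "0 < t" "c * t \<le> e"
      using \<open>0 < e\<close> \<open>0 \<le> c\<close> by (auto simp: t_def field_simps)
    have "1 + t = N ((1 + t) *\<^sub>R u)"
      using t is_norm_scaleR[OF N, of "1 + t" u] Nu by simp
    also have "(1 + t) *\<^sub>R u = t *\<^sub>R (u + h) + (u + (- t) *\<^sub>R h)"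
      by (simp add: algebra_simps)
    also have "N \<dots> \<le> t * N (u + h) + N (u + (- t) *\<^sub>R h)"
      using is_norm_triangle[OF N] is_norm_scaleR[OF N] t by (metis abs_of_pos)
    also have "\<dots> \<le> t * N (u + h) + (1 - t * (p \<bullet> h) + t\<^sup>2 * c)"
      using upper[of "(- t) *\<^sub>R h"] by (simp add: c_def power_mult_distrib mult.left_commute)
    finally have "t * (1 + p \<bullet> h) \<le> t * (N (u + h) + c * t)"
      by (simp add: algebra_simps power2_eq_square)
    then have "1 + p \<bullet> h \<le> N (u + h) + c * t"
      using t(1) by simp
    then show "1 + p \<bullet> h \<le> N (u + h) + e"
      using t(2) by linarith
  qed
  show ?thesis
    by (rule that[OF Nu pw _ lower upper]) (use S in auto)
qed

text \<open>This is strict Frechet differentiability at \<open>u\<close>: both points vary. The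
  contraction argument compares two arbitrary points near \<open>u\<close>, so control of increments
  starting at \<open>u\<close> would not suffice.\<close>

definition strict_gradient :: "('a::real_inner \<Rightarrow> real) \<Rightarrow> 'a \<Rightarrow> 'a \<Rightarrow> bool" where
  "strict_gradient N u p \<longleftrightarrow> (\<forall>\<eta>>0. \<exists>\<epsilon>>0. \<forall>y y'. norm y \<le> \<epsilon> \<longrightarrow> norm y' \<le> \<epsilon> \<longrightarrow>
     \<bar>N (u + y) - N (u + y') - p \<bullet> (y - y')\<bar> \<le> \<eta> * norm (y - y'))"

text \<open>By convexity, the slope of \<open>N\<close> from \<open>y'\<close> to \<open>y\<close>
  is at most the slope from \<open>y'\<close> to a point \<open>z\<close> farther along the same
  ray. With \<open>z\<close> at distance \<open>2 * \<epsilon>\<close>, the quadratic error at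
  \<open>z\<close> contributes only a multiple of \<open>\<epsilon>\<close> to that slope.\<close>

lemma strict_gradientI_quadratic:
  assumes N: "is_norm N" and "0 \<le> C"
    and lower: "\<And>h. 1 + p \<bullet> h \<le> N (u + h)"
    and upper: "\<And>h. N (u + h) \<le> 1 + p \<bullet> h + C * (norm h)\<^sup>2"
  shows "strict_gradient N u p"
  unfolding strict_gradient_def
proof (intro allI impI)
  fix \<eta> :: real assume "0 < \<eta>"
  \<comment> \<open>The error in the slope is at most
    \<open>C * (3 * \<epsilon>)\<^sup>2 / (2 * \<epsilon>)\<close>, that is
    \<open>9 / 2 * C * \<epsilon>\<close>; the \<open>+ 1\<close> covers
    \<open>C = 0\<close>.\<close>
  define \<epsilon> where "\<epsilon> = \<eta> / (5 * C + 1)"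
  have eps: "0 < \<epsilon>" "9 / 2 * C * \<epsilon> \<le> \<eta>"
    using \<open>0 < \<eta>\<close> \<open>0 \<le> C\<close> by (auto simp: \<epsilon>_def field_simps)
  have main: "N (u + y) - N (u + y') - p \<bullet> (y - y') \<le> \<eta> * norm (y - y')"
    if y: "norm y \<le> \<epsilon>" "norm y' \<le> \<epsilon>" for y y'
  proof (cases "y = y'")
    case False
    define k where "k = y - y'"
    define \<theta> where "\<theta> = norm k / (2 * \<epsilon>)"
    have "norm k \<le> 2 * \<epsilon>"
      using norm_triangle_ineq4[of y y'] y by (simp add: k_def)
    then have th: "0 < \<theta>" "\<theta> \<le> 1"
      using False eps by (auto simp: \<theta>_def k_def)
    define z where "z = y' + (1 / \<theta>) *\<^sub>R k"
    have "norm ((1 / \<theta>) *\<^sub>R k) = 2 * \<epsilon>"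
      using False eps by (simp add: \<theta>_def k_def)
    then have "norm z \<le> 3 * \<epsilon>"
      using norm_triangle_ineq[of y' "(1 / \<theta>) *\<^sub>R k"] y by (simp add: z_def)
    then have z2: "(norm z)\<^sup>2 \<le> 9 * \<epsilon>\<^sup>2"
      using power_mono[of "norm z" "3 * \<epsilon>" 2] by (simp add: power_mult_distrib)
    have tz: "\<theta> *\<^sub>R z = \<theta> *\<^sub>R y' + k"
      using th by (simp add: z_def algebra_simps)
    have "u + y = (1 - \<theta>) *\<^sub>R (u + y') + \<theta> *\<^sub>R (u + z)"
      using tz by (simp add: algebra_simps k_def)
    then have "N (u + y) \<le> (1 - \<theta>) * N (u + y') + \<theta> * N (u + z)"
      using is_norm_triangle[OF N] is_norm_scaleR[OF N] th
      by (metis abs_of_nonneg abs_of_pos diff_ge_0_iff_ge)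
    then have "N (u + y) - N (u + y') \<le> \<theta> * (N (u + z) - N (u + y'))"
      by (simp add: algebra_simps)
    also have "\<dots> \<le> \<theta> * (p \<bullet> (z - y') + C * (norm z)\<^sup>2)"
      using upper[of z] lower[of y'] th by (intro mult_left_mono) (auto simp: inner_diff_right)
    also have "\<dots> = p \<bullet> k + \<theta> * (C * (norm z)\<^sup>2)"
      using th by (simp add: z_def algebra_simps)
    also have "\<dots> \<le> p \<bullet> k + \<theta> * (C * (9 * \<epsilon>\<^sup>2))"
      using z2 th \<open>0 \<le> C\<close> by (intro add_left_mono mult_left_mono) auto
    also have "\<dots> = p \<bullet> k + (9 / 2 * C * \<epsilon>) * norm k"
      using eps by (simp add: \<theta>_def power2_eq_square)
    also have "\<dots> \<le> p \<bullet> k + \<eta> * norm k"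
      using eps by (intro add_left_mono mult_right_mono) auto
    finally show ?thesis by (simp add: k_def)
  qed auto
  \<comment> \<open>Exchanging \<open>y\<close> and \<open>y'\<close> in the one-sided estimate
    gives the other side.\<close>
  have "\<bar>N (u + y) - N (u + y') - p \<bullet> (y - y')\<bar> \<le> \<eta> * norm (y - y')"
    if y: "norm y \<le> \<epsilon>" "norm y' \<le> \<epsilon>" for y y'
    using main[OF y] main[OF y(2,1)] by (simp add: inner_diff_right norm_minus_commute)
  then show "\<exists>\<epsilon>>0. \<forall>y y'. norm y \<le> \<epsilon> \<longrightarrow> norm y' \<le> \<epsilon> \<longrightarrow>
     \<bar>N (u + y) - N (u + y') - p \<bullet> (y - y')\<bar> \<le> \<eta> * norm (y - y')"
    using eps(1) by blast
qed

section \<open>A basis of strict gradients and its dual basis\<close>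

text \<open>The vector \<open>e q\<close> is the component of \<open>q\<close> orthogonal to the
  span of the other basis elements, rescaled. The expansion holds because the difference of its two
  sides is orthogonal to all of \<open>B\<close>.\<close>

lemma dual_basis_exists:
  fixes B :: "'a::euclidean_space set"
  assumes B: "independent B" "span B = UNIV"
  obtains e where "\<And>p q. p \<in> B \<Longrightarrow> q \<in> B \<Longrightarrow> p \<bullet> e q = (if p = q then 1 else 0)"
    "\<And>x. x = (\<Sum>p\<in>B. (p \<bullet> x) *\<^sub>R e p)"
proof -
  have fin: "finite B"
    using B independent_imp_finite by blast
  have "\<exists>f. q \<bullet> f = 1 \<and> (\<forall>p\<in>B - {q}. p \<bullet> f = 0)" if "q \<in> B" for q
  proof -
    obtain y z where yz: "y \<in> span (B - {q})" "\<And>w. w \<in> span (B - {q}) \<Longrightarrow> orthogonal z w"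
      "q = y + z"
      using orthogonal_subspace_decomp_exists[of "B - {q}" q] by blast
    have "z \<noteq> 0"
      using B(1) that yz(1,3) by (auto simp: dependent_def)
    moreover have "q \<bullet> z = z \<bullet> z"
      using yz(2)[OF yz(1)] yz(3) by (simp add: orthogonal_def inner_add_left inner_commute[of z y])
    ultimately have "q \<bullet> ((1 / (z \<bullet> z)) *\<^sub>R z) = 1"
      by simp
    moreover have "\<forall>p\<in>B - {q}. p \<bullet> ((1 / (z \<bullet> z)) *\<^sub>R z) = 0"
      using yz(2)[OF span_base] by (simp add: orthogonal_def inner_commute)
    ultimately show ?thesis by blast
  qed
  then obtain e where e: "\<And>q. q \<in> B \<Longrightarrow> q \<bullet> e q = 1 \<and> (\<forall>p\<in>B - {q}. p \<bullet> e q = 0)"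
    by metis
  then have dual: "p \<bullet> e q = (if p = q then 1 else 0)" if "p \<in> B" "q \<in> B" for p q
    using that by auto
  have "x = (\<Sum>p\<in>B. (p \<bullet> x) *\<^sub>R e p)" for x
  proof -
    define d where "d = x - (\<Sum>p\<in>B. (p \<bullet> x) *\<^sub>R e p)"
    have "q \<bullet> d = 0" if "q \<in> B" for q
    proof -
      have "q \<bullet> (\<Sum>p\<in>B. (p \<bullet> x) *\<^sub>R e p) = (\<Sum>p\<in>B. if q = p then p \<bullet> x else 0)"
        unfolding inner_sum_right using dual that by (intro sum.cong) auto
      then show ?thesis
        using that fin by (simp add: d_def inner_diff_right)
    qed
    then have "orthogonal d q" if "q \<in> B" for q
      using that by (metis orthogonal_def inner_commute)
    then have "orthogonal d d"
      using orthogonal_to_span[of d B d] B(2) by auto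
    then show ?thesis
      by (simp add: orthogonal_self d_def)
  qed
  with dual show ?thesis by (intro that)
qed

text \<open>If the strict gradients at unit vectors did not span, some nonzero \<open>w\<close>
  would be orthogonal to all of them, but \<open>quadratic_supporting_point\<close> applied to
  \<open>w\<close> yields one with \<open>p \<bullet> w \<noteq> 0\<close>.\<close>

lemma strict_gradient_basis:
  fixes N :: "'a::euclidean_space \<Rightarrow> real"
  assumes N: "is_norm N"
  obtains B u where "independent B" "span B = UNIV" "card B = DIM('a)"
    "\<And>p. p \<in> B \<Longrightarrow> N (u p) = 1 \<and> strict_gradient N (u p) p"
proof -
  define P where "P = {p. \<exists>u. N u = 1 \<and> strict_gradient N u p}"
  obtain B where B: "B \<subseteq> P" "independent B" "P \<subseteq> span B"
    using maximal_independent_subset by blast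
  have "span P = UNIV"
  proof (rule ccontr)
    assume "span P \<noteq> UNIV"
    then have "span P \<subset> span UNIV" by auto
    then obtain w where w: "w \<noteq> 0" "\<And>y. y \<in> span P \<Longrightarrow> orthogonal w y"
      using orthogonal_to_subspace_exists_gen[of P UNIV] by metis
    obtain u p C where upC: "N u = 1" "p \<bullet> w \<noteq> 0" "0 \<le> C"
      "\<And>h. 1 + p \<bullet> h \<le> N (u + h)" "\<And>h. N (u + h) \<le> 1 + p \<bullet> h + C * (norm h)\<^sup>2"
      using quadratic_supporting_point[OF N w(1)] by metis
    have "p \<in> P"
      using strict_gradientI_quadratic[OF N upC(3-5)] upC(1) by (auto simp: P_def)
    then show False
      using w(2)[OF span_base] upC(2) by (simp add: orthogonal_def inner_commute)
  qed
  then have "span B = UNIV"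
    using B by (metis span_mono span_span top.extremum_uniqueI)
  moreover have "card B = DIM('a)"
    using dim_eq_card_independent[OF B(2)] \<open>span B = UNIV\<close> by (metis dim_UNIV dim_span)
  moreover have "\<forall>p\<in>B. \<exists>u. N u = 1 \<and> strict_gradient N u p"
    using B(1) by (auto simp: P_def)
  then obtain u where "\<And>p. p \<in> B \<Longrightarrow> N (u p) = 1 \<and> strict_gradient N (u p) p"
    unfolding bchoice_iff by blast
  ultimately show ?thesis
    using that B(2) by blast
qed

section \<open>Many unit vectors in a group of small rank\<close>

lemma strict_gradient_uniform:
  assumes "finite B" "\<And>p. p \<in> B \<Longrightarrow> strict_gradient N (u p) p" "0 < \<eta>"
  obtains \<epsilon> where "0 < \<epsilon>" "\<And>p y y'. p \<in> B \<Longrightarrow> norm y \<le> \<epsilon> \<Longrightarrow> norm y' \<le> \<epsilon> \<Longrightarrow>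
     \<bar>N (u p + y) - N (u p + y') - p \<bullet> (y - y')\<bar> \<le> \<eta> * norm (y - y')"
proof -
  have "\<forall>p\<in>B. \<exists>\<epsilon>>0. \<forall>y y'. norm y \<le> \<epsilon> \<longrightarrow> norm y' \<le> \<epsilon> \<longrightarrow>
     \<bar>N (u p + y) - N (u p + y') - p \<bullet> (y - y')\<bar> \<le> \<eta> * norm (y - y')"
    using assms(2,3) unfolding strict_gradient_def by blast
  then obtain r where r: "\<forall>p\<in>B. 0 < r p \<and> (\<forall>y y'. norm y \<le> r p \<longrightarrow> norm y' \<le> r p \<longrightarrow>
     \<bar>N (u p + y) - N (u p + y') - p \<bullet> (y - y')\<bar> \<le> \<eta> * norm (y - y'))"
    unfolding bchoice_iff by blast
  define \<epsilon> where "\<epsilon> = Min (insert 1 (r ` B))"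
  have "\<epsilon> \<le> r p" if "p \<in> B" for p
    using assms(1) that by (auto simp: \<epsilon>_def)
  moreover have "0 < \<epsilon>"
    using assms(1) r by (auto simp: \<epsilon>_def)
  ultimately show ?thesis
    using r by (intro that[of \<epsilon>]) (meson order_trans)+
qed

text \<open>In the coordinates \<open>(p \<bullet> x)\<^sub>p\<close> the equations \<open>N (u p + x - t *\<^sub>R e p) = 1\<close> are a small
  perturbation of \<open>p \<bullet> x = t\<close>, so Newton's iteration with constant slope contracts.\<close>

lemma simultaneous_unit_translate:
  fixes N :: "'a::euclidean_space \<Rightarrow> real"
  assumes fin: "finite B"
    and dual: "\<And>p q. p \<in> B \<Longrightarrow> q \<in> B \<Longrightarrow> p \<bullet> e q = (if p = q then 1 else 0)"
    and repr: "\<And>x. x = (\<Sum>p\<in>B. (p \<bullet> x) *\<^sub>R e p)"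
    and Nu: "\<And>p. p \<in> B \<Longrightarrow> N (u p) = 1"
    and lin: "\<And>p y y'. p \<in> B \<Longrightarrow> norm y \<le> \<epsilon> \<Longrightarrow> norm y' \<le> \<epsilon> \<Longrightarrow>
      \<bar>N (u p + y) - N (u p + y') - p \<bullet> (y - y')\<bar> \<le> \<eta> * norm (y - y')"
    and E: "E = (\<Sum>p\<in>B. norm (e p))" and \<eta>: "0 \<le> \<eta>" "\<eta> * E \<le> 1 / 2"
    and r: "0 < r" "2 * r \<le> \<epsilon>" and t: "0 \<le> t" "4 * (t * E) \<le> r"
  obtains x where "norm x \<le> r" "\<And>p. p \<in> B \<Longrightarrow> N (u p + (x - t *\<^sub>R e p)) = 1"
proof -
  define F where "F x p = N (u p + (x - t *\<^sub>R e p)) - 1" for x p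
  \<comment> \<open>Since the \<open>e p\<close> are dual to \<open>B\<close>, a fixed point of
    \<open>f\<close> is a common zero of all \<open>F x p\<close> with \<open>p\<close> in
    \<open>B\<close>.\<close>
  define f where "f x = x - (\<Sum>p\<in>B. F x p *\<^sub>R e p)" for x
  have eE: "norm (e p) \<le> E" if "p \<in> B" for p
    unfolding E using fin that by (intro member_le_sum) auto
  have E0: "0 \<le> E" unfolding E by (intro sum_nonneg) auto
  have small: "norm (x - t *\<^sub>R e p) \<le> \<epsilon>" if "norm x \<le> r" "p \<in> B" for x p
  proof -
    have "norm (x - t *\<^sub>R e p) \<le> norm x + norm (t *\<^sub>R e p)"
      by (rule norm_triangle_ineq4)
    moreover have "norm (t *\<^sub>R e p) \<le> t * E"
      using eE[OF that(2)] t by (simp add: mult_left_mono)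
    ultimately show ?thesis
      using that(1) r t by linarith
  qed
  have contr: "norm (f x - f x') \<le> 1 / 2 * norm (x - x')" if x: "norm x \<le> r" "norm x' \<le> r" for x x'
  proof -
    \<comment> \<open>Expanding \<open>x - x'\<close> in the \<open>e p\<close> cancels the linear
      parts and leaves only the errors bounded by \<open>lin\<close>.\<close>
    have "f x - f x' = (\<Sum>p\<in>B. (p \<bullet> (x - x')) *\<^sub>R e p) - (\<Sum>p\<in>B. (F x p - F x' p) *\<^sub>R e p)"
      using repr[of "x - x'"] by (simp add: f_def scaleR_diff_left sum_subtractf)
    also have "\<dots> = (\<Sum>p\<in>B. (p \<bullet> (x - x') - (F x p - F x' p)) *\<^sub>R e p)"
      by (simp add: scaleR_diff_left sum_subtractf)
    also have "norm \<dots> \<le> (\<Sum>p\<in>B. norm ((p \<bullet> (x - x') - (F x p - F x' p)) *\<^sub>R e p))"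
      by (rule norm_sum)
    also have "\<dots> \<le> (\<Sum>p\<in>B. \<eta> * norm (x - x') * norm (e p))"
    proof (rule sum_mono)
      fix p assume p: "p \<in> B"
      have "\<bar>p \<bullet> (x - x') - (F x p - F x' p)\<bar> \<le> \<eta> * norm (x - x')"
        using lin[OF p small[OF x(1) p] small[OF x(2) p]]
        by (simp add: F_def abs_minus_commute)
      then show "norm ((p \<bullet> (x - x') - (F x p - F x' p)) *\<^sub>R e p) \<le> \<eta> * norm (x - x') * norm (e p)"
        by (simp add: mult_right_mono)
    qed
    also have "\<dots> = \<eta> * E * norm (x - x')"
      by (simp add: E sum_distrib_left[symmetric])
    also have "\<dots> \<le> 1 / 2 * norm (x - x')"
      using \<eta> by (intro mult_right_mono) auto
    finally show ?thesis .
  qed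
  \<comment> \<open>Each \<open>F 0 p\<close> is within \<open>t\<close> of \<open>- t\<close>.
    Together with the contraction factor 1/2, the resulting bound \<open>r / 2\<close> makes the
    ball of radius \<open>r\<close> invariant.\<close>
  have f0: "norm (f 0) \<le> r / 2"
  proof -
    have "norm (f 0) = norm (\<Sum>p\<in>B. F 0 p *\<^sub>R e p)"
      by (simp add: f_def)
    also have "\<dots> \<le> (\<Sum>p\<in>B. norm (F 0 p *\<^sub>R e p))"
      by (rule norm_sum)
    also have "\<dots> \<le> (\<Sum>p\<in>B. 2 * t * norm (e p))"
    proof (rule sum_mono)
      fix p assume p: "p \<in> B"
      have "\<bar>F 0 p + t\<bar> \<le> \<eta> * (t * norm (e p))"
        using lin[OF p small[of 0, OF _ p], of 0] r t Nu[OF p] dual[OF p p]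
        by (simp add: F_def)
      also have "\<dots> \<le> t * (\<eta> * E)"
        using t \<eta> eE[OF p] by (simp add: mult.left_commute mult_left_mono)
      also have "\<dots> \<le> t"
        using t \<eta> mult_left_mono[of "\<eta> * E" 1 t] by simp
      finally have "\<bar>F 0 p\<bar> \<le> 2 * t" using t by linarith
      then show "norm (F 0 p *\<^sub>R e p) \<le> 2 * t * norm (e p)"
        by (simp add: mult_right_mono)
    qed
    also have "\<dots> = 2 * (t * E)"
      by (simp add: E sum_distrib_left[symmetric])
    finally show ?thesis using t by linarith
  qed
  have "\<exists>!x\<in>cball 0 r. f x = x"
  proof (rule Banach_fix)
    show "f ` cball 0 r \<subseteq> cball 0 r"
    proof clarsimp
      fix x :: 'a assume "norm x \<le> r"
      then show "norm (f x) \<le> r"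
        using contr[of x 0] f0 r norm_triangle_sub[of "f x" "f 0"] by simp
    qed
    show "dist (f x) (f y) \<le> 1 / 2 * dist x y" if "x \<in> cball 0 r" "y \<in> cball 0 r" for x y
      using contr that by (simp add: dist_norm)
  qed (use r in \<open>auto simp: complete_eq_closed\<close>)
  then obtain x where x: "norm x \<le> r" "f x = x"
    by auto
  have "F x q = 0" if q: "q \<in> B" for q
  proof -
    have "0 = q \<bullet> (\<Sum>p\<in>B. F x p *\<^sub>R e p)"
      using x(2) by (simp add: f_def)
    also have "\<dots> = (\<Sum>p\<in>B. if q = p then F x p else 0)"
      unfolding inner_sum_right using dual q by (intro sum.cong) auto
    also have "\<dots> = F x q"
      using q fin by simp
    finally show ?thesis by simp
  qed
  then show ?thesis
    using x(1) by (intro that[of x]) (auto simp: F_def)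
qed

text \<open>For each \<open>i\<close> a single \<open>x i\<close> serves all \<open>p\<close> in
  \<open>B\<close>, so the vectors are integer combinations of only \<open>m + 2 * DIM('a)\<close>
  generators. They are told apart by the local behaviour of \<open>N\<close>: its increments along
  the \<open>e q\<close> reveal \<open>p\<close> and exclude antipodal pairs, and a second basis
  element then reveals \<open>i\<close>.\<close>

lemma many_unit_vectors:
  fixes N :: "'a::euclidean_space \<Rightarrow> real" and m :: nat
  assumes N: "is_norm N" and d: "2 \<le> DIM('a)"
  obtains B :: "'a set" and x u w v where "finite B" "card B = DIM('a)"
    "v = (\<lambda>(i, p). x i + u p - real i *\<^sub>R w p)"
    "\<And>k. k \<in> {..<m} \<times> B \<Longrightarrow> N (v k) = 1"
    "inj_on v ({..<m} \<times> B)"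
    "\<And>k k'. k \<in> {..<m} \<times> B \<Longrightarrow> k' \<in> {..<m} \<times> B \<Longrightarrow> v k \<noteq> - v k'"
proof -
  obtain B u where B: "independent B" "span B = UNIV" "card B = DIM('a)"
    and u: "\<And>p. p \<in> B \<Longrightarrow> N (u p) = 1" "\<And>p. p \<in> B \<Longrightarrow> strict_gradient N (u p) p"
    using strict_gradient_basis[OF N] by metis
  have fin: "finite B"
    using B independent_imp_finite by blast
  obtain e where dual: "\<And>p q. p \<in> B \<Longrightarrow> q \<in> B \<Longrightarrow> p \<bullet> e q = (if p = q then 1 else 0)"
    and repr: "\<And>x. x = (\<Sum>p\<in>B. (p \<bullet> x) *\<^sub>R e p)"
    using dual_basis_exists[OF B(1,2)] by metis
  define E where "E = (\<Sum>p\<in>B. norm (e p))"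
  \<comment> \<open>The \<open>+ 1\<close> makes \<open>\<eta> * E < 1 / 2\<close> strict, on which
    the distinctness arguments below depend.\<close>
  define \<eta> where "\<eta> = 1 / (2 * (E + 1))"
  have eE: "norm (e p) \<le> E" if "p \<in> B" for p
    unfolding E_def using fin that by (intro member_le_sum) auto
  have E0: "0 \<le> E" unfolding E_def by (intro sum_nonneg) auto
  have \<eta>: "0 < \<eta>" "\<eta> * E < 1 / 2"
    using E0 by (auto simp: \<eta>_def field_simps)
  obtain \<epsilon> where eps: "0 < \<epsilon>"
    and lin: "\<And>p y y'. p \<in> B \<Longrightarrow> norm y \<le> \<epsilon> \<Longrightarrow> norm y' \<le> \<epsilon> \<Longrightarrow>
      \<bar>N (u p + y) - N (u p + y') - p \<bullet> (y - y')\<bar> \<le> \<eta> * norm (y - y')"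
    using strict_gradient_uniform[OF fin u(2) \<eta>(1)] by blast
  define r where "r = \<epsilon> / 4"
  define T where "T = r / (4 * (E + 1))"
  have r: "0 < r" "4 * r = \<epsilon>"
    using eps by (auto simp: r_def)
  have T: "0 < T" "4 * (T * E) \<le> r"
    using r E0 by (auto simp: T_def field_simps)
  \<comment> \<open>Equal steps make \<open>t i *\<^sub>R e p\<close> the integer multiple
    \<open>real i *\<^sub>R w p\<close> of a generator independent of \<open>i\<close>. Dividing by
    \<open>m + 1\<close> keeps all \<open>t i\<close> within \<open>T\<close>.\<close>
  define t where "t i = real i * (T / real (m + 1))" for i
  have t: "0 \<le> t i" "t i \<le> T" if "i < m" for i
  proof -
    have "real i / real (m + 1) \<le> 1" using that by simp
    from mult_left_mono[OF this, of T] T show "t i \<le> T"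
      by (simp add: t_def mult.commute)
  qed (use T in \<open>auto simp: t_def\<close>)
  have t4: "4 * (t i * E) \<le> r" if "i < m" for i
    using t[OF that] T E0 mult_right_mono[of "t i" T E] by linarith
  have "\<forall>i\<in>{..<m}. \<exists>x. norm x \<le> r \<and> (\<forall>p\<in>B. N (u p + (x - t i *\<^sub>R e p)) = 1)"
  proof
    fix i assume i: "i \<in> {..<m}"
    show "\<exists>x. norm x \<le> r \<and> (\<forall>p\<in>B. N (u p + (x - t i *\<^sub>R e p)) = 1)"
      by (rule simultaneous_unit_translate[OF fin dual repr u(1) lin E_def, where r = r and t = "t i"])
        (use \<eta> r t t4 i eps in auto)
  qed
  then obtain x where x: "\<And>i. i < m \<Longrightarrow> norm (x i) \<le> r"
    and Nx: "\<And>i p. i < m \<Longrightarrow> p \<in> B \<Longrightarrow> N (u p + (x i - t i *\<^sub>R e p)) = 1"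
    unfolding bchoice_iff by auto
  define y where "y i p = x i - t i *\<^sub>R e p" for i p
  have y: "norm (y i p) \<le> 2 * r" if "i < m" "p \<in> B" for i p
  proof -
    have "norm (t i *\<^sub>R e p) \<le> t i * E"
      using eE[OF that(2)] t[OF that(1)] by (simp add: mult_left_mono)
    then show ?thesis
      using norm_triangle_ineq4[of "x i" "t i *\<^sub>R e p"] x[OF that(1)] t4[OF that(1)] r
      unfolding y_def by linarith
  qed
  define w where "w p = (T / real (m + 1)) *\<^sub>R e p" for p
  define v where "v = (\<lambda>(i, p). x i + u p - real i *\<^sub>R w p)"
  have v: "v (i, p) = u p + y i p" for i p
    by (simp add: v_def y_def w_def t_def)
  define s where "s = r / (E + 1)"
  have s: "0 < s" "s * E \<le> r"
    using r E0 by (auto simp: s_def field_simps)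
  \<comment> \<open>An increment along \<open>e q\<close> is close to \<open>c\<close> if
    \<open>q = p\<close> and close to 0 otherwise; the error below \<open>s / 2\<close> keeps the
    two cases apart.\<close>
  have step: "\<bar>N (v (i, p) + c *\<^sub>R e q) - N (v (i, p)) - c * (p \<bullet> e q)\<bar> < s / 2"
    if "i < m" "p \<in> B" "q \<in> B" "\<bar>c\<bar> = s" for i p q c
  proof -
    have ce: "norm (c *\<^sub>R e q) \<le> s * E"
      using eE[OF that(3)] that(4) s by (simp add: mult_left_mono)
    then have "norm (y i p + c *\<^sub>R e q) \<le> \<epsilon>" "norm (y i p) \<le> \<epsilon>"
      using norm_triangle_ineq[of "y i p" "c *\<^sub>R e q"] y[OF that(1,2)] s r by linarith+
    from lin[OF that(2) this]
    have "\<bar>N (v (i, p) + c *\<^sub>R e q) - N (v (i, p)) - c * (p \<bullet> e q)\<bar> \<le> \<eta> * norm (c *\<^sub>R e q)"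
      by (simp add: v add.assoc)
    also have "\<dots> \<le> s * (\<eta> * E)"
      using mult_left_mono[OF ce, of \<eta>] \<eta> by (simp add: mult.left_commute)
    also have "\<dots> < s / 2"
      using mult_strict_left_mono[OF \<eta>(2) s(1)] by simp
    finally show ?thesis .
  qed
  have antipodal: "v k \<noteq> - v k'" if kk: "k \<in> {..<m} \<times> B" "k' \<in> {..<m} \<times> B" for k k'
  proof
    assume eq: "v k = - v k'"
    obtain i p i' p' where k: "k = (i, p)" "k' = (i', p')" "i < m" "p \<in> B" "i' < m" "p' \<in> B"
      using kk by auto
    \<comment> \<open>Moving \<open>v k\<close> by \<open>s *\<^sub>R e p\<close> raises the norm by
      more than \<open>s / 2\<close>. For the antipode \<open>v k'\<close> this is a move by
      \<open>- s *\<^sub>R e p\<close>, which raises it by less than \<open>s / 2\<close>.\<close>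
    have "N (v (i, p) + s *\<^sub>R e p) = N (v (i', p') + (- s) *\<^sub>R e p)"
      using eq is_norm_minus[OF N, of "v (i', p') + (- s) *\<^sub>R e p"] k by simp
    moreover have "N (v (i, p)) = N (v (i', p'))"
      using eq is_norm_minus[OF N, of "v (i', p')"] k by simp
    moreover have "0 \<le> s * (p' \<bullet> e p)"
      using dual[of p' p] k s by simp
    moreover have "N (v (i, p) + s *\<^sub>R e p) - N (v (i, p)) > s / 2"
      using step[OF k(3,4,4), of s] s(1) dual[of p p] k(4)
      by (simp add: abs_less_iff) argo
    moreover have "N (v (i', p') + (- s) *\<^sub>R e p) - N (v (i', p')) < s / 2 - s * (p' \<bullet> e p)"
      using step[OF k(5,6,4), of "- s"] s(1)
      by (simp add: abs_less_iff) argo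
    ultimately show False
      by linarith
  qed
  have inj: "inj_on v ({..<m} \<times> B)"
  proof (rule inj_onI)
    fix k k' assume kk: "k \<in> {..<m} \<times> B" "k' \<in> {..<m} \<times> B" and eq: "v k = v k'"
    obtain i p i' p' where k: "k = (i, p)" "k' = (i', p')" "i < m" "p \<in> B" "i' < m" "p' \<in> B"
      using kk by auto
    have pp: "p = p'"
    proof (rule ccontr)
      assume "p \<noteq> p'"
      then show False
        using step[OF k(3,4,4), of s] step[OF k(5,6,4), of s] s(1) dual[of p p] dual[of p' p] k eq
        by (simp add: abs_less_iff) argo
    qed
    have yy: "y i p = y i' p"
      using eq pp k by (simp add: v)
    \<comment> \<open>Here dimension at least 2 enters. Both \<open>u q + y i q\<close> and
      \<open>u q + y i' q\<close> are unit vectors, but they differ by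
      \<open>c *\<^sub>R (e p - e q)\<close>, whose product with \<open>q\<close> is
      \<open>- c\<close>. Near-linearity of \<open>N\<close> then forces
      \<open>c = 0\<close>.\<close>
    have "\<exists>q. q \<in> B \<and> q \<noteq> p"
    proof (rule ccontr)
      assume "\<nexists>q. q \<in> B \<and> q \<noteq> p"
      then have "B \<subseteq> {p}" by auto
      from card_mono[OF _ this] d B(3) show False by simp
    qed
    then obtain q where q: "q \<in> B" "q \<noteq> p" by blast
    define c where "c = t i - t i'"
    have dy: "y i q - y i' q = c *\<^sub>R (e p - e q)"
      using yy by (simp add: y_def c_def algebra_simps)
    have "norm (y i q) \<le> \<epsilon>" "norm (y i' q) \<le> \<epsilon>"
      using y[OF k(3) q(1)] y[OF k(5) q(1)] r by linarith+
    from lin[OF q(1) this] have "\<bar>c\<bar> \<le> \<eta> * (\<bar>c\<bar> * norm (e p - e q))"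
      using Nx[OF k(3) q(1)] Nx[OF k(5) q(1)] dual[OF q(1) q(1)] dual[OF q(1) k(4)] q(2)
      by (simp add: dy y_def[symmetric] inner_diff_right)
    also have "\<dots> \<le> \<bar>c\<bar> * (\<eta> * (2 * E))"
      using norm_triangle_ineq4[of "e p" "e q"] eE[OF k(4)] eE[OF q(1)] \<eta>
      by (simp add: mult.left_commute mult_left_mono)
    finally have "\<bar>c\<bar> \<le> \<bar>c\<bar> * (\<eta> * (2 * E))" .
    moreover have "\<bar>c\<bar> * (\<eta> * (2 * E)) < \<bar>c\<bar> * 1" if "c \<noteq> 0"
      using \<eta>(2) that by (intro mult_strict_left_mono) auto
    ultimately have "c = 0"
      by linarith
    then have "i = i'"
      using T by (auto simp: c_def t_def)
    then show "k = k'"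
      using k pp by simp
  qed
  show ?thesis
  proof (rule that[OF fin B(3) v_def _ inj antipodal])
    show "N (v k) = 1" if "k \<in> {..<m} \<times> B" for k
      using that Nx by (auto simp: v y_def)
  qed
qed

section \<open>Counting unit distances\<close>

text \<open>This replaces injectivity of \<open>\<phi>\<close>. Let \<open>L t\<close> be the set of
  points with more than \<open>t\<close> preimages; the layer sizes add up to \<open>card A\<close>.
  Since \<open>\<sigma> k\<close> is injective, the part of \<open>D k\<close> over \<open>b\<close>
  is no larger than the fibre over \<open>b\<close> or over \<open>b + v k\<close>, so it is counted
  by the layers containing both points. Hence the layers have average density at least
  \<open>c\<close>, and some nonempty layer attains it.\<close>

lemma dense_layer:
  fixes \<phi> :: "'i \<Rightarrow> 'a::ab_group_add" and v :: "'k \<Rightarrow> 'a" and c :: real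
  assumes fin: "finite A" "A \<noteq> {}"
    and DA: "\<And>k. k \<in> K \<Longrightarrow> D k \<subseteq> A"
    and inj: "\<And>k. k \<in> K \<Longrightarrow> inj_on (\<sigma> k) (D k)"
    and \<sigma>A: "\<And>k. k \<in> K \<Longrightarrow> \<sigma> k ` D k \<subseteq> A"
    and shift: "\<And>k a. k \<in> K \<Longrightarrow> a \<in> D k \<Longrightarrow> \<phi> (\<sigma> k a) = \<phi> a + v k"
    and dense: "c * real (card A) \<le> (\<Sum>k\<in>K. real (card (D k)))"
  obtains P where "finite P" "P \<noteq> {}" "card P \<le> card A"
    "c * real (card P) \<le> (\<Sum>k\<in>K. real (card {b \<in> P. b + v k \<in> P}))"
proof -
  define F where "F b = {a \<in> A. \<phi> a = b}" for b
  define L where "L t = {b \<in> \<phi> ` A. t < card (F b)}" for t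
  have finF: "finite (F b)" for b using fin by (simp add: F_def)
  have finL: "finite (L t)" for t using fin by (simp add: L_def)
  have cF: "card (F b) \<le> card A" for b
    unfolding F_def using fin by (intro card_mono) auto
  have cardL: "card (L t) \<le> card A" for t
  proof -
    have "card (L t) \<le> card (\<phi> ` A)"
      using fin by (intro card_mono) (auto simp: L_def)
    also have "\<dots> \<le> card A" by (rule card_image_le[OF fin(1)])
    finally show ?thesis .
  qed
  have sumL: "(\<Sum>t<card A. card (L t)) = card A"
  proof -
    have "(\<Sum>t<card A. card (L t)) = (\<Sum>t<card A. \<Sum>b\<in>\<phi> ` A. if t < card (F b) then 1 else 0)"
      using fin by (intro sum.cong) (auto simp: L_def sum.If_cases Int_def)
    also have "\<dots> = (\<Sum>b\<in>\<phi> ` A. \<Sum>t<card A. if t < card (F b) then 1 else 0)"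
      by (rule sum.swap)
    also have "\<dots> = (\<Sum>b\<in>\<phi> ` A. card (F b))"
    proof (rule sum.cong[OF refl])
      fix b
      have "{..<card A} \<inter> {t. t < card (F b)} = {..<card (F b)}"
        using cF[of b] by auto
      then show "(\<Sum>t<card A. if t < card (F b) then 1 else 0) = card (F b)"
        by (simp add: sum.If_cases)
    qed
    also have "\<dots> = card A"
      using sum.group[of A "\<phi> ` A" \<phi> "\<lambda>_. 1::nat"] fin by (simp add: F_def)
    finally show ?thesis .
  qed
  have cardD: "card (D k) \<le> (\<Sum>t<card A. card {b \<in> L t. b + v k \<in> L t})" if k: "k \<in> K" for k
  proof -
    have finD: "finite (D k)" using DA[OF k] fin finite_subset by blast
    \<comment> \<open>The sum on the right is the smaller of the two fibre sizes whenever
      \<open>b + v k\<close> is in the image of \<open>\<phi>\<close>.\<close>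
    have *: "card {a \<in> D k. \<phi> a = b} \<le> (\<Sum>t<card A. if b \<in> L t \<and> b + v k \<in> L t then 1 else 0)"
      if b: "b \<in> \<phi> ` A" for b
    proof (cases "{a \<in> D k. \<phi> a = b} = {}")
      case False
      have le1: "card {a \<in> D k. \<phi> a = b} \<le> card (F b)"
        using DA[OF k] by (intro card_mono finF) (auto simp: F_def)
      have "card {a \<in> D k. \<phi> a = b} = card (\<sigma> k ` {a \<in> D k. \<phi> a = b})"
        using inj_on_subset[OF inj[OF k], of "{a \<in> D k. \<phi> a = b}"] by (subst card_image) auto
      also have "\<dots> \<le> card (F (b + v k))"
        using \<sigma>A[OF k] shift[OF k] by (intro card_mono finF) (auto simp: F_def)
      finally have le2: "card {a \<in> D k. \<phi> a = b} \<le> card (F (b + v k))" .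
      from False have "b + v k \<in> \<phi> ` A"
        using shift[OF k] \<sigma>A[OF k] by force
      then have "{..<card {a \<in> D k. \<phi> a = b}} \<subseteq> {..<card A} \<inter> {t. b \<in> L t \<and> b + v k \<in> L t}"
        using b le1 le2 cF[of b] by (auto simp: L_def)
      from card_mono[OF _ this] show ?thesis
        by (simp add: sum.If_cases)
    next
      case True
      then show ?thesis by (simp only: card.empty le0)
    qed
    have "card (D k) = (\<Sum>b\<in>\<phi> ` A. card {a \<in> D k. \<phi> a = b})"
      using sum.group[of "D k" "\<phi> ` A" \<phi> "\<lambda>_. 1::nat"] fin finD DA[OF k]
      by (simp add: image_mono)
    also have "\<dots> \<le> (\<Sum>b\<in>\<phi> ` A. \<Sum>t<card A. if b \<in> L t \<and> b + v k \<in> L t then 1 else 0)"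
      by (intro sum_mono *)
    also have "\<dots> = (\<Sum>t<card A. \<Sum>b\<in>\<phi> ` A. if b \<in> L t \<and> b + v k \<in> L t then 1 else 0)"
      by (rule sum.swap)
    also have "\<dots> = (\<Sum>t<card A. card {b \<in> L t. b + v k \<in> L t})"
    proof (rule sum.cong[OF refl])
      fix t
      have "\<phi> ` A \<inter> {b. b \<in> L t \<and> b + v k \<in> L t} = {b \<in> L t. b + v k \<in> L t}"
        by (auto simp: L_def)
      then show "(\<Sum>b\<in>\<phi> ` A. if b \<in> L t \<and> b + v k \<in> L t then 1 else 0)
          = card {b \<in> L t. b + v k \<in> L t}"
        using fin by (simp add: sum.If_cases)
    qed
    finally show ?thesis .
  qed
  define G where "G P = (\<Sum>k\<in>K. real (card {b \<in> P. b + v k \<in> P}))" for P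
  have "\<exists>t<card A. L t \<noteq> {} \<and> c * real (card (L t)) \<le> G (L t)"
  proof (rule ccontr)
    assume "\<not> ?thesis"
    then have lt: "G (L t) < c * real (card (L t))" if "t < card A" "L t \<noteq> {}" for t
      using that by force
    then have le: "G (L t) \<le> c * real (card (L t))" if "t < card A" for t
      using that by (cases "L t = {}") (auto simp: G_def intro: less_imp_le)
    have A0: "0 < card A" using fin by (simp add: card_gt_0_iff)
    \<comment> \<open>Empty layers give equality, so a nonempty layer is required for the sum
      inequality to be strict.\<close>
    have "L 0 \<noteq> {}"
    proof -
      obtain a where "a \<in> A" using fin by auto
      then have "\<phi> a \<in> L 0"
        using finF[of "\<phi> a"] by (auto simp: L_def card_gt_0_iff F_def)
      then show ?thesis by auto
    qed
    then have "(\<Sum>t<card A. G (L t)) < (\<Sum>t<card A. c * real (card (L t)))"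
      using A0 le lt by (intro sum_strict_mono_ex1) auto
    also have "\<dots> = c * real (\<Sum>t<card A. card (L t))"
      by (simp add: sum_distrib_left)
    also have "\<dots> \<le> (\<Sum>k\<in>K. real (card (D k)))"
      using dense by (simp add: sumL)
    also have "\<dots> \<le> (\<Sum>k\<in>K. \<Sum>t<card A. real (card {b \<in> L t. b + v k \<in> L t}))"
      unfolding of_nat_sum[symmetric] of_nat_le_iff by (intro sum_mono cardD)
    also have "\<dots> = (\<Sum>t<card A. G (L t))"
      unfolding G_def by (rule sum.swap)
    finally show False by simp
  qed
  then obtain t where "L t \<noteq> {}" "c * real (card (L t)) \<le> G (L t)"
    by blast
  then show ?thesis
    by (intro that[of "L t"] finL cardL) (simp_all add: G_def)
qed

section \<open>Unit pairs from translation vectors and disjoint copies\<close>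

lemma finite_unit_pairs:
  assumes "finite P"
  shows "finite (unit_pairs N P)"
proof (rule finite_subset)
  show "unit_pairs N P \<subseteq> Pow P" by (auto simp: unit_pairs_def)
qed (use assms in simp)

lemma unit_pairs_mono: "P \<subseteq> Q \<Longrightarrow> unit_pairs N P \<subseteq> unit_pairs N Q"
  by (auto simp: unit_pairs_def)

text \<open>The map from \<open>(k, b)\<close> to \<open>{b, b + v k}\<close> is injective: two
  representations with the same orientation give \<open>v k = v k'\<close>, and opposite
  orientations give the excluded \<open>v k = - v k'\<close>.\<close>

lemma sum_translates_le_card_unit_pairs:
  fixes v :: "'k \<Rightarrow> 'a::real_vector"
  assumes fin: "finite P" "finite K"
    and unit: "\<And>k. k \<in> K \<Longrightarrow> N (v k) = 1"
    and inj: "inj_on v K"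
    and anti: "\<And>k k'. k \<in> K \<Longrightarrow> k' \<in> K \<Longrightarrow> v k \<noteq> - v k'"
  shows "(\<Sum>k\<in>K. card {b \<in> P. b + v k \<in> P}) \<le> card (unit_pairs N P)"
proof -
  define S where "S = (SIGMA k:K. {b \<in> P. b + v k \<in> P})"
  define g where "g = (\<lambda>(k, b). {b, b + v k})"
  have "inj_on g S"
  proof (rule inj_onI)
    fix x y assume xy: "x \<in> S" "y \<in> S" "g x = g y"
    obtain k b k' b' where x: "x = (k, b)" "y = (k', b')" "k \<in> K" "k' \<in> K"
      using xy by (auto simp: S_def)
    have "b = b' \<and> b + v k = b' + v k' \<or> b = b' + v k' \<and> b + v k = b'"
      using xy(3) by (auto simp: g_def x doubleton_eq_iff)
    then show "x = y"
    proof
      assume "b = b' \<and> b + v k = b' + v k'"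
      then show ?thesis using inj x by (auto dest: inj_onD)
    next
      assume "b = b' + v k' \<and> b + v k = b'"
      then have "b' + (v k' + v k) = b'" by (metis add.assoc)
      then have "v k = - v k'" by (simp add: eq_neg_iff_add_eq_0 add.commute)
      then show ?thesis using anti x by blast
    qed
  qed
  moreover have "g ` S \<subseteq> unit_pairs N P"
  proof
    fix y assume "y \<in> g ` S"
    then obtain k b where kb: "k \<in> K" "b \<in> P" "b + v k \<in> P" "y = {b + v k, b}"
      by (auto simp: S_def g_def)
    then show "y \<in> unit_pairs N P"
      using unit[OF kb(1)] unfolding unit_pairs_def by force
  qed
  moreover have "card S = (\<Sum>k\<in>K. card {b \<in> P. b + v k \<in> P})"
    using fin by (simp add: S_def card_SigmaI)
  ultimately show ?thesis
    using card_inj_on_le finite_unit_pairs[OF fin(1)] by metis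
qed

lemma card_unit_pairs_translate:
  "card (unit_pairs N ((+) z ` P)) = card (unit_pairs N P)"
proof -
  have "unit_pairs N ((+) z ` P) = image ((+) z) ` unit_pairs N P"
  proof
    show "unit_pairs N ((+) z ` P) \<subseteq> image ((+) z) ` unit_pairs N P"
    proof
      fix e assume "e \<in> unit_pairs N ((+) z ` P)"
      then obtain x y where "x \<in> P" "y \<in> P" "N (x - y) = 1" "e = (+) z ` {x, y}"
        by (auto simp: unit_pairs_def)
      then show "e \<in> image ((+) z) ` unit_pairs N P"
        unfolding unit_pairs_def by blast
    qed
    show "image ((+) z) ` unit_pairs N P \<subseteq> unit_pairs N ((+) z ` P)"
    proof clarify
      fix e assume "e \<in> unit_pairs N P"
      then obtain x y where xy: "x \<in> P" "y \<in> P" "N (x - y) = 1" "e = {x, y}"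
        by (auto simp: unit_pairs_def)
      then have "(+) z ` e = {z + x, z + y}" "N ((z + x) - (z + y)) = 1" by auto
      then show "(+) z ` e \<in> unit_pairs N ((+) z ` P)"
        unfolding unit_pairs_def using xy by blast
    qed
  qed
  moreover have "inj (image ((+) z) :: 'a set \<Rightarrow> 'a set)"
    by (intro injI) (simp add: inj_image_eq_iff)
  ultimately show ?thesis
    by (simp add: card_image inj_on_subset)
qed

text \<open>A translate of \<open>P\<close> by \<open>z\<close> misses the finite set
  \<open>Q\<close> as soon as \<open>z\<close> is not a difference of a point of \<open>Q\<close>
  and a point of \<open>P\<close>.\<close>

lemma disjoint_translates:
  fixes P :: "'a::euclidean_space set"
  assumes P: "finite P" "P \<noteq> {}"
  shows "\<exists>Q. finite Q \<and> card Q = q * card P \<and> q * card (unit_pairs N P) \<le> card (unit_pairs N Q)"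
proof (induction q)
  case 0
  then show ?case by (intro exI[of _ "{}"]) simp
next
  case (Suc q)
  then obtain Q where Q: "finite Q" "card Q = q * card P"
    "q * card (unit_pairs N P) \<le> card (unit_pairs N Q)" by blast
  have "finite ((\<lambda>(x, y). x - y) ` (Q \<times> P))"
    using Q P by simp
  moreover have "infinite (UNIV :: 'a set)"
    by (metis finite_imp_bounded not_bounded_UNIV)
  ultimately obtain z where z: "z \<notin> (\<lambda>(x, y). x - y) ` (Q \<times> P)"
    using ex_new_if_finite by blast
  define R where "R = (+) z ` P"
  have disj: "Q \<inter> R = {}"
    using z by (force simp: R_def)
  have R: "finite R" "card R = card P" "card (unit_pairs N R) = card (unit_pairs N P)"
    using P by (auto simp: R_def card_image card_unit_pairs_translate)
  have "unit_pairs N Q \<inter> unit_pairs N R = {}"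
    using disj unfolding unit_pairs_def by (auto simp: doubleton_eq_iff)
  then have "card (unit_pairs N Q) + card (unit_pairs N R) = card (unit_pairs N Q \<union> unit_pairs N R)"
    using Q(1) R(1) by (simp add: card_Un_disjoint finite_unit_pairs)
  also have "\<dots> \<le> card (unit_pairs N (Q \<union> R))"
    using Q(1) R(1) by (intro card_mono finite_unit_pairs Un_least unit_pairs_mono) auto
  finally have "Suc q * card (unit_pairs N P) \<le> card (unit_pairs N (Q \<union> R))"
    using Q R by simp
  moreover have "card (Q \<union> R) = Suc q * card P"
    using Q R disj by (simp add: card_Un_disjoint)
  ultimately show ?case
    using Q(1) R(1) by (intro exI[of _ "Q \<union> R"]) simp
qed

text \<open>Disjoint copies of \<open>P\<close> are padded with arbitrary further points to
  \<open>n\<close> points, which destroys no unit pair.\<close>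

lemma max_unit_distances_ge:
  fixes P :: "'a::euclidean_space set"
  assumes P: "finite P" "P \<noteq> {}" and q: "q * card P \<le> n"
  shows "q * card (unit_pairs N P) \<le> max_unit_distances N n"
proof -
  obtain Q where Q: "finite Q" "card Q = q * card P"
    "q * card (unit_pairs N P) \<le> card (unit_pairs N Q)"
    using disjoint_translates[OF P] by blast
  have "infinite (UNIV - Q :: 'a set)"
    using Q(1) by (metis Diff_infinite_finite finite_imp_bounded not_bounded_UNIV)
  then obtain R where R: "finite R" "card R = n - card Q" "R \<subseteq> UNIV - Q"
    using infinite_arbitrarily_large by blast
  then have "card (Q \<union> R) = n"
    using Q q by (subst card_Un_disjoint) auto
  then have "card (unit_pairs N (Q \<union> R)) \<le> max_unit_distances N n"
    unfolding max_unit_distances_def using Q R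
    by (intro Max_ge finite_unit_pair_counts) blast
  moreover have "card (unit_pairs N Q) \<le> card (unit_pairs N (Q \<union> R))"
    using Q R by (intro card_mono finite_unit_pairs unit_pairs_mono) auto
  ultimately show ?thesis using Q(3) by linarith
qed

section \<open>Edge density of the grid\<close>

text \<open>These are the grid points whose coordinate \<open>j\<close> can be raised by
  \<open>a\<close> without leaving the grid; only the factor at \<open>j\<close> shrinks.\<close>

lemma card_PiE_update_bound:
  assumes "finite B" "j \<in> B" "a \<le> L"
  shows "card {f \<in> B \<rightarrow>\<^sub>E {..<L}. f j + a < L} = (L - a) * L ^ (card B - 1)"
proof -
  have "{f \<in> B \<rightarrow>\<^sub>E {..<L}. f j + a < L} = (\<Pi>\<^sub>E k\<in>B. if k = j then {..<L - a} else {..<L})"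
    using assms by (auto simp: PiE_iff extensional_def less_diff_conv split: if_splits)
  then have "card {f \<in> B \<rightarrow>\<^sub>E {..<L}. f j + a < L}
      = (\<Prod>k\<in>B. card (if k = j then {..<L - a} else {..<L}))"
    using assms by (simp add: card_PiE)
  also have "\<dots> = card {..<L - a} * (\<Prod>k\<in>B - {j}. card (if k = j then {..<L - a} else {..<L}))"
    using assms by (subst prod.remove[of B j]) auto
  also have "(\<Prod>k\<in>B - {j}. card (if k = j then {..<L - a} else {..<L})) = (\<Prod>k\<in>B - {j}. L)"
    by (intro prod.cong) auto
  finally show ?thesis
    using assms by (simp add: card_Diff_singleton)
qed

text \<open>The grid is \<open>{0,1}\<^sup>m \<times> [L]\<^sup>B \<times> [L]\<^sup>B\<close>, whose last two factors record the multiples of the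
  \<open>u p\<close> and \<open>- w p\<close>. Since only \<open>m\<close> of its \<open>m + 2 * card B * log 2 L\<close> bits are of the first kind,
  the latter are asymptotically free.\<close>

lemma dense_unit_distance_set:
  fixes N :: "'a::euclidean_space \<Rightarrow> real"
  assumes N: "is_norm N" and d: "2 \<le> DIM('a)" and mL: "0 < m" "m \<le> L"
  obtains P where "finite P" "P \<noteq> {}" "card P \<le> 2 ^ m * L ^ (2 * DIM('a))"
    "(1 - 1 / L) * (1 - m / L) / 2 * (DIM('a) * m) * card P \<le> card (unit_pairs N P)"
proof -
  obtain B :: "'a set" and x u w v where fin: "finite B" and cB: "card B = DIM('a)"
    and v: "v = (\<lambda>(i, p). x i + u p - real i *\<^sub>R w p)"
    and unit: "\<And>k. k \<in> {..<m} \<times> B \<Longrightarrow> N (v k) = 1"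
    and inj: "inj_on v ({..<m} \<times> B)"
    and anti: "\<And>k k'. k \<in> {..<m} \<times> B \<Longrightarrow> k' \<in> {..<m} \<times> B \<Longrightarrow> v k \<noteq> - v k'"
    by (rule many_unit_vectors[OF N d, where m = m]) (rule that)
  define d where "d = DIM('a)"
  define K where "K = {..<m} \<times> B"
  define X where "X = B \<rightarrow>\<^sub>E {..<L}"
  define A where "A = Pow {..<m} \<times> X \<times> X"
  define \<phi> where "\<phi> = (\<lambda>(S, f, g). (\<Sum>i\<in>S. x i) + (\<Sum>p\<in>B. real (f p) *\<^sub>R u p)
    - (\<Sum>p\<in>B. real (g p) *\<^sub>R w p))"
  \<comment> \<open>\<open>D (i, p)\<close> holds the grid points at which \<open>v (i, p)\<close>
    can be added within the grid, and \<open>\<sigma> (i, p)\<close> performs the addition on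
    coefficients. The coefficient of \<open>- w p\<close> grows by \<open>i\<close>, which is why
    \<open>L\<close> must be large compared with \<open>m\<close>.\<close>
  define D where "D = (\<lambda>(i, p). Pow ({..<m} - {i}) \<times> {f \<in> X. f p + 1 < L} \<times> {g \<in> X. g p + i < L})"
  define \<sigma> where "\<sigma> = (\<lambda>(i :: nat, p :: 'a) (S, f :: 'a \<Rightarrow> nat, g :: 'a \<Rightarrow> nat).
    (insert i S, f(p := f p + 1), g(p := g p + i)))"
  have L0: "0 < L" using mL by simp
  have finX: "finite X" unfolding X_def using fin by (intro finite_PiE) auto
  have cX: "card X = L ^ d" using fin cB by (simp add: X_def card_PiE d_def)
  have finA: "finite A" using finX by (simp add: A_def)
  have cA: "card A = 2 ^ m * L ^ (2 * d)"
    by (simp add: A_def card_cartesian_product card_Pow cX power_add[symmetric] mult_2)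
  have "A \<noteq> {}" using cA L0 by auto
  have upd: "(\<Sum>q\<in>B. real ((f(p := f p + a)) q) *\<^sub>R z q) = (\<Sum>q\<in>B. real (f q) *\<^sub>R z q) + real a *\<^sub>R z p"
    if "p \<in> B" for f :: "'a \<Rightarrow> nat" and z :: "'a \<Rightarrow> 'a" and p a
  proof -
    have "(\<Sum>q\<in>B. real ((f(p := f p + a)) q) *\<^sub>R z q)
        = (\<Sum>q\<in>B. real (f q) *\<^sub>R z q + (if q = p then real a *\<^sub>R z p else 0))"
      by (intro sum.cong) (auto simp: scaleR_add_left)
    then show ?thesis
      using that fin by (simp add: sum.distrib)
  qed
  have updX: "f(p := f p + a) \<in> X" if "f \<in> X" "p \<in> B" "f p + a < L" for f p a
    using that by (auto simp: X_def PiE_iff extensional_def)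
  obtain P where P: "finite P" "P \<noteq> {}" "card P \<le> card A"
    "(1 - 1 / L) * (1 - m / L) / 2 * (d * m) * real (card P) \<le> (\<Sum>k\<in>K. real (card {b \<in> P. b + v k \<in> P}))"
  proof (rule dense_layer[OF finA \<open>A \<noteq> {}\<close>, of K D \<sigma> \<phi> v])
    fix k assume "k \<in> K"
    then obtain i p where k: "k = (i, p)" "i < m" "p \<in> B"
      by (auto simp: K_def)
    show "D k \<subseteq> A"
      by (auto simp: D_def A_def k)
    show "inj_on (\<sigma> k) (D k)"
    proof (rule inj_onI)
      fix a b assume ab: "a \<in> D k" "b \<in> D k" "\<sigma> k a = \<sigma> k b"
      obtain S f g S' f' g' where a: "a = (S, f, g)" "b = (S', f', g')"
        by (cases a, cases b)
      have i: "i \<notin> S" "i \<notin> S'"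
        using ab(1,2) by (auto simp: D_def k a)
      have eq: "insert i S = insert i S'" "f(p := f p + 1) = f'(p := f' p + 1)"
        "g(p := g p + i) = g'(p := g' p + i)"
        using ab(3) by (auto simp: \<sigma>_def k a)
      have "S = S'"
        using eq(1) i by auto
      moreover have "f = f'"
      proof
        fix q show "f q = f' q" using fun_cong[OF eq(2), of q] by (auto split: if_splits)
      qed
      moreover have "g = g'"
      proof
        fix q show "g q = g' q" using fun_cong[OF eq(3), of q] by (auto split: if_splits)
      qed
      ultimately show "a = b" using a by simp
    qed
    show "\<sigma> k ` D k \<subseteq> A"
      using k updX updX[where a = 1] by (auto simp: \<sigma>_def D_def A_def)
    show "\<phi> (\<sigma> k a) = \<phi> a + v k" if a: "a \<in> D k" for a
    proof -
      obtain S f g where S: "a = (S, f, g)" "i \<notin> S" "S \<subseteq> {..<m}"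
        using a by (auto simp: D_def k)
      have "finite S" using S(3) finite_subset by blast
      then have "(\<Sum>i\<in>insert i S. x i) = x i + (\<Sum>i\<in>S. x i)"
        using S(2) by simp
      then show ?thesis
        using upd[OF k(3), of f 1 u] upd[OF k(3), of g i w]
        by (simp add: \<phi>_def \<sigma>_def S(1) k(1) v algebra_simps)
    qed
  next
    \<comment> \<open>The condition that \<open>i\<close> is absent from the subset costs a factor
      1/2; the room for \<open>u p\<close> and \<open>- w p\<close> costs \<open>1 - 1 / L\<close>
      and \<open>1 - i / L\<close>.\<close>
    have cD: "real (card A) * ((1 - 1 / L) * (1 - m / L) / 2) \<le> real (card (D k))" if "k \<in> K" for k
    proof -
      obtain i p where k: "k = (i, p)" "i < m" "p \<in> B"
        using \<open>k \<in> K\<close> by (auto simp: K_def)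
      have "card (Pow ({..<m} - {i})) = 2 ^ (m - 1)"
        using k by (simp add: card_Pow)
      moreover have "card {f \<in> X. f p + 1 < L} = (L - 1) * L ^ (d - 1)"
        unfolding X_def using card_PiE_update_bound[OF fin k(3), of 1 L] L0 cB by (simp add: d_def)
      moreover have "card {g \<in> X. g p + i < L} = (L - i) * L ^ (d - 1)"
        unfolding X_def using card_PiE_update_bound[OF fin k(3), of i L] mL k(2) cB by (simp add: d_def)
      ultimately have "card (D k) = 2 ^ (m - 1) * (((L - 1) * L ^ (d - 1)) * ((L - i) * L ^ (d - 1)))"
        by (simp add: D_def k card_cartesian_product)
      moreover have "2 ^ m = (2::real) * 2 ^ (m - 1)"
        using mL(1) by (cases m) auto
      moreover have "real L ^ (2 * d) = real L * real L ^ (d - 1) * (real L * real L ^ (d - 1))"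
        using \<open>2 \<le> DIM('a)\<close> by (cases d) (auto simp: d_def mult_2 power_add)
      moreover have "real (L - 1) = real L * (1 - 1 / L)" "real (L - i) = real L * (1 - i / L)"
        using L0 mL k(2) by (auto simp: right_diff_distrib of_nat_diff)
      ultimately have "real (card (D k)) = real (card A) * ((1 - 1 / L) * (1 - i / L) / 2)"
        by (simp add: cA)
      moreover have "(1 - 1 / L) * (1 - m / L) \<le> (1 - 1 / real L) * (1 - i / L)"
        using L0 k(2) by (intro mult_left_mono diff_left_mono divide_right_mono) auto
      ultimately show ?thesis
        by (simp add: mult_left_mono)
    qed
    have "card K = d * m"
      using cB by (simp add: K_def d_def card_cartesian_product)
    then have "(1 - 1 / L) * (1 - m / L) / 2 * (d * m) * real (card A)
        = (\<Sum>k\<in>K. real (card A) * ((1 - 1 / L) * (1 - m / L) / 2))"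
      by simp
    also have "\<dots> \<le> (\<Sum>k\<in>K. real (card (D k)))"
      by (intro sum_mono cD)
    finally show "(1 - 1 / L) * (1 - m / L) / 2 * (d * m) * real (card A) \<le> (\<Sum>k\<in>K. real (card (D k)))" .
  qed
  have "(\<Sum>k\<in>K. card {b \<in> P. b + v k \<in> P}) \<le> card (unit_pairs N P)"
    unfolding K_def using P(1) fin unit inj anti by (intro sum_translates_le_card_unit_pairs) auto
  then have "(\<Sum>k\<in>K. real (card {b \<in> P. b + v k \<in> P})) \<le> card (unit_pairs N P)"
    by (simp only: of_nat_sum[symmetric] of_nat_le_iff)
  then show ?thesis
    using P cA by (intro that[of P]) (auto simp: d_def)
qed

text \<open>As many disjoint copies of the dense set as fit leave fewer than \<open>card P\<close>
  of the \<open>n\<close> points over, and each point in a copy contributes at least the density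
  factor on average.\<close>

lemma max_unit_distances_lower_bound:
  fixes N :: "'a::euclidean_space \<Rightarrow> real" and m L n :: nat
  assumes N: "is_norm N" and d: "2 \<le> DIM('a)" and mL: "m \<le> L"
  shows "(real n - 2 ^ m * real L ^ (2 * DIM('a))) * ((1 - 1 / L) * (1 - m / L) / 2 * (DIM('a) * m))
    \<le> max_unit_distances N n"
proof (cases "m = 0")
  case False
  define c where "c = (1 - 1 / L) * (1 - m / L) / 2 * (DIM('a) * m)"
  have c: "0 \<le> c" using mL False by (auto simp: c_def)
  obtain P where P: "finite P" "P \<noteq> {}" "card P \<le> 2 ^ m * L ^ (2 * DIM('a))"
    "c * card P \<le> card (unit_pairs N P)"
    using dense_unit_distance_set[OF N d _ mL] False unfolding c_def by blast
  have "0 < card P" using P by (simp add: card_gt_0_iff)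
  have "n = n div card P * card P + n mod card P" by simp
  also have "\<dots> \<le> n div card P * card P + 2 ^ m * L ^ (2 * DIM('a))"
    using P(3) mod_less_divisor[OF \<open>0 < card P\<close>, of n] by linarith
  finally have "real n \<le> real (n div card P * card P + 2 ^ m * L ^ (2 * DIM('a)))"
    by (rule of_nat_mono)
  then have "(real n - 2 ^ m * real L ^ (2 * DIM('a))) * c \<le> real (n div card P) * card P * c"
    using c by (intro mult_right_mono) auto
  also have "\<dots> \<le> real (n div card P) * card (unit_pairs N P)"
    using mult_left_mono[OF P(4), of "real (n div card P)"] by (simp add: mult_ac)
  also have "\<dots> \<le> max_unit_distances N n"
    using max_unit_distances_ge[OF P(1,2), of "n div card P" n N]
    by (metis div_times_less_eq_dividend of_nat_le_iff of_nat_mult)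
  finally show ?thesis by (simp add: c_def)
qed simp

section \<open>Choice of parameters and asymptotics\<close>

text \<open>With side length \<open>L = m\<^sup>2\<close>, both \<open>1 / L\<close> and
  \<open>m / L\<close> vanish in the limit. The grid size is \<open>2 ^ m * m ^ (4 * d)\<close>: in
  the definition of \<open>m\<close>, the \<open>4 * d\<close> iterated logarithms offset the
  polynomial factor and the extra one makes the size \<open>o(n)\<close>, while \<open>m\<close>
  stays asymptotic to \<open>log 2 n\<close>.\<close>

lemma unit_distance_asymptotics:
  fixes d :: nat
  defines "m \<equiv> \<lambda>n. nat \<lfloor>log 2 (real n) - (4 * d + 1) * log 2 (log 2 (real n))\<rfloor>"
  shows "(\<lambda>n. (real n - 2 ^ m n * real ((m n)\<^sup>2) ^ (2 * d)) *
      ((1 - 1 / real ((m n)\<^sup>2)) * (1 - m n / real ((m n)\<^sup>2)) / 2 * (d * m n)) /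
      (real n * log 2 (real n))) \<longlonglongrightarrow> real d / 2"
proof -
  define x where "x n = log 2 (real n)" for n :: nat
  define y where "y n = x n - (4 * real d + 1) * log 2 (x n)" for n
  have m: "m n = nat \<lfloor>y n\<rfloor>" for n
    by (simp add: m_def y_def x_def add.commute[of 1])
  have y_top: "filterlim y at_top sequentially"
    unfolding y_def x_def by real_asymp
  have x2: "eventually (\<lambda>n. 2 \<le> x n) sequentially"
    unfolding x_def by real_asymp
  have y1: "eventually (\<lambda>n. 1 \<le> y n) sequentially"
    using y_top by (simp add: filterlim_at_top)
  \<comment> \<open>Once \<open>y n\<close> is at least 1, \<open>nat\<close> does not truncate and
    the floor loses at most 1.\<close>
  have bounds: "eventually (\<lambda>n. y n - 1 \<le> m n \<and> real (m n) \<le> y n) sequentially"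
    using y1
  proof eventually_elim
    case (elim n)
    then have "real (m n) = of_int \<lfloor>y n\<rfloor>"
      by (simp add: m)
    then show ?case by linarith
  qed
  have m_top: "filterlim (\<lambda>n. real (m n)) at_top sequentially"
  proof (rule filterlim_at_top_mono)
    show "filterlim (\<lambda>n. y n - 1) at_top sequentially"
      unfolding y_def x_def by real_asymp
  qed (use bounds in eventually_elim, auto)
  have "(\<lambda>n. real (m n) / x n) \<longlonglongrightarrow> 1"
  proof (rule tendsto_sandwich)
    show "(\<lambda>n. (y n - 1) / x n) \<longlonglongrightarrow> 1" "(\<lambda>n. y n / x n) \<longlonglongrightarrow> 1"
      unfolding y_def x_def by real_asymp+
    show "eventually (\<lambda>n. (y n - 1) / x n \<le> real (m n) / x n) sequentially"
      "eventually (\<lambda>n. real (m n) / x n \<le> y n / x n) sequentially"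
      using bounds x2 by (eventually_elim, simp add: divide_right_mono)+
  qed
  moreover have "(\<lambda>n. 2 ^ m n * real ((m n)\<^sup>2) ^ (2 * d) / real n) \<longlonglongrightarrow> 0"
  proof (rule tendsto_sandwich)
    show "(\<lambda>n. 0) \<longlonglongrightarrow> (0::real)" by simp
    show "(\<lambda>n. 1 / x n) \<longlonglongrightarrow> 0"
      unfolding x_def by real_asymp
    show "eventually (\<lambda>n. 2 ^ m n * real ((m n)\<^sup>2) ^ (2 * d) / real n \<le> 1 / x n) sequentially"
      using bounds x2 eventually_gt_at_top[of 0]
    proof eventually_elim
      case (elim n)
      have "(2::real) ^ m n = 2 powr real (m n)"
        by (simp add: powr_realpow)
      also have "\<dots> \<le> 2 powr y n"
        using elim by simp
      also have "\<dots> = real n / x n powr (real (4 * d + 1))"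
      proof -
        have "2 powr x n = real n"
          using elim by (simp add: x_def)
        moreover have "2 powr log 2 (x n) = x n"
          using elim by simp
        moreover have "y n = x n - log 2 (x n) * real (4 * d + 1)"
          by (simp add: y_def algebra_simps)
        ultimately show ?thesis
          by (simp only: powr_diff powr_powr[symmetric])
      qed
      also have "\<dots> = real n / x n ^ (4 * d + 1)"
        using elim by (subst powr_realpow) auto
      finally have 1: "2 ^ m n \<le> real n / x n ^ (4 * d + 1)" .
      have "0 \<le> (4 * real d + 1) * log 2 (x n)"
        using elim by simp
      then have "real (m n) \<le> x n"
        using elim unfolding y_def by linarith
      then have "real (m n) ^ (4 * d) \<le> x n ^ (4 * d)"
        by (intro power_mono) auto
      then have 2: "real ((m n)\<^sup>2) ^ (2 * d) \<le> x n ^ (4 * d)"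
        by (simp add: power_mult[symmetric])
      have "2 ^ m n * real ((m n)\<^sup>2) ^ (2 * d) \<le> real n / x n ^ (4 * d + 1) * x n ^ (4 * d)"
        by (rule mult_mono[OF 1 2]) (use elim in simp_all)
      also have "\<dots> = real n / x n"
        using elim by simp
      finally show ?case
        using elim by (simp add: field_simps)
    qed
  qed auto
  moreover have "(\<lambda>n. 1 / real ((m n)\<^sup>2)) \<longlonglongrightarrow> 0"
  proof -
    have "((\<lambda>t::real. 1 / t\<^sup>2) \<longlongrightarrow> 0) at_top"
      by real_asymp
    from filterlim_compose[OF this m_top] show ?thesis
      by simp
  qed
  moreover have "(\<lambda>n. real (m n) / real ((m n)\<^sup>2)) \<longlonglongrightarrow> 0"
  proof -
    have "((\<lambda>t::real. t / t\<^sup>2) \<longlongrightarrow> 0) at_top"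
      by real_asymp
    from filterlim_compose[OF this m_top] show ?thesis
      by simp
  qed
  ultimately have "(\<lambda>n. (1 - 2 ^ m n * real ((m n)\<^sup>2) ^ (2 * d) / real n) *
      ((1 - 1 / real ((m n)\<^sup>2)) * (1 - m n / real ((m n)\<^sup>2)) / 2 * (real d * (m n / x n))))
      \<longlonglongrightarrow> (1 - 0) * ((1 - 0) * (1 - 0) / 2 * (real d * 1))"
    by (intro tendsto_intros) auto
  then have "(\<lambda>n. (1 - 2 ^ m n * real ((m n)\<^sup>2) ^ (2 * d) / real n) *
      ((1 - 1 / real ((m n)\<^sup>2)) * (1 - m n / real ((m n)\<^sup>2)) / 2 * (real d * (m n / x n))))
      \<longlonglongrightarrow> real d / 2"
    by simp
  then show ?thesis
  proof (rule Lim_transform_eventually)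
    have "eventually (\<lambda>n::nat. 0 < n) sequentially" by (rule eventually_gt_at_top)
    then show "eventually (\<lambda>n. (1 - 2 ^ m n * real ((m n)\<^sup>2) ^ (2 * d) / real n) *
      ((1 - 1 / real ((m n)\<^sup>2)) * (1 - m n / real ((m n)\<^sup>2)) / 2 * (real d * (m n / x n))) =
      (real n - 2 ^ m n * real ((m n)\<^sup>2) ^ (2 * d)) *
      ((1 - 1 / real ((m n)\<^sup>2)) * (1 - m n / real ((m n)\<^sup>2)) / 2 * (d * m n)) /
      (real n * log 2 (real n))) sequentially"
    proof eventually_elim
      case (elim n)
      have "1 - 2 ^ m n * real ((m n)\<^sup>2) ^ (2 * d) / real n
          = (real n - 2 ^ m n * real ((m n)\<^sup>2) ^ (2 * d)) / real n"
        using elim by (simp add: diff_divide_distrib)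
      then show ?case by (simp add: x_def)
    qed
  qed
qed

theorem theorem1p4:
  assumes "CARD('d::finite) \<ge> 2"
  shows "\<exists>\<epsilon> :: nat \<Rightarrow> real. \<epsilon> \<longlonglongrightarrow> 0 \<and>
    (\<forall>N :: real ^ 'd \<Rightarrow> real. is_norm N \<longrightarrow>
      (\<forall>n\<ge>1. real (max_unit_distances N n)
                \<ge> (real CARD('d) / 2 - \<epsilon> n) * real n * log 2 (real n)))"
proof -
  define d where "d = CARD('d)"
  define m where "m n = nat \<lfloor>log 2 (real n) - (4 * d + 1) * log 2 (log 2 (real n))\<rfloor>" for n
  define G where "G n = (real n - 2 ^ m n * real ((m n)\<^sup>2) ^ (2 * d)) *
      ((1 - 1 / real ((m n)\<^sup>2)) * (1 - m n / real ((m n)\<^sup>2)) / 2 * (d * m n))" for n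
  \<comment> \<open>This gap between \<open>d / 2\<close> and the normalised explicit bound does not
    involve \<open>N\<close>, so one sequence serves all norms.\<close>
  define \<epsilon> where "\<epsilon> n = real d / 2 - G n / (real n * log 2 (real n))" for n
  have "(\<lambda>n. G n / (real n * log 2 (real n))) \<longlonglongrightarrow> real d / 2"
    unfolding G_def m_def by (rule unit_distance_asymptotics)
  then have "\<epsilon> \<longlonglongrightarrow> real d / 2 - real d / 2"
    unfolding \<epsilon>_def by (intro tendsto_diff tendsto_const)
  then have "\<epsilon> \<longlonglongrightarrow> 0"
    by simp
  moreover have "(real CARD('d) / 2 - \<epsilon> n) * real n * log 2 (real n) \<le> max_unit_distances N n"
    if N: "is_norm N" and "1 \<le> n" for N :: "real ^ 'd \<Rightarrow> real" and n
  \<comment> \<open>For \<open>n = 1\<close> the logarithm vanishes and the bound is 0, so the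
    division by zero in \<open>\<epsilon> 1\<close> is harmless.\<close>
  proof (cases "n = 1")
    case False
    define X where "X = real n * log 2 (real n)"
    have "0 < X"
      unfolding X_def using False \<open>1 \<le> n\<close>
      by (intro mult_pos_pos) (auto simp: zero_less_log_cancel_iff)
    then have "(real d / 2 - \<epsilon> n) * X = G n"
      by (simp add: \<epsilon>_def X_def[symmetric])
    then have "(real CARD('d) / 2 - \<epsilon> n) * real n * log 2 (real n) = G n"
      by (simp add: X_def d_def mult.assoc)
    also have "G n \<le> max_unit_distances N n"
    proof -
      have dim: "DIM(real ^ 'd) = d"
        by (simp add: d_def)
      have "m n \<le> (m n)\<^sup>2"
        by (simp add: power2_eq_square)
      moreover have "2 \<le> DIM(real ^ 'd)"
        using assms by simp
      ultimately show ?thesis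
        using max_unit_distances_lower_bound[OF N, of "m n" "(m n)\<^sup>2" n] unfolding G_def dim by blast
    qed
    finally show ?thesis .
  qed simp
  ultimately show ?thesis
    by blast
qed

end
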